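(* Let $A\in\mathbb{K}^{m\times n}$, $X\in\mathbb{K}^{n\times p}$, $Y\in\mathbb{K}^{m\times q}$, and assume that $\operatorname{rank}(Y^*AX)=k$ (the matrix $Y^*AX$ is possibly non-square). Then \[\operatorname{rank}\left(A-(AX)(Y^*AX)^+(Y^*A)\right)=\operatorname{rank}A-k.\]
   Context: $\mathbb{K}=\mathbb{R}$ or $\mathbb{K}=\mathbb{C}$; $\mathbb{K}^{m\times n}$ is the set of $m\times n$ matrices over $\mathbb{K}$; $M^*$ is the conjugate transpose of $M$ and $M^+$ is its Moore--Penrose pseudoinverse. *)

theory Defs
  imports "Jordan_Normal_Form.DL_Rank" "Jordan_Normal_Form.Schur_Decomposition"
begin

text \<open>The four Penrose conditions. The dimensions of \<open>N\<close> are required explicitly,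
  because matrices carry their dimensions as data rather than in their type.\<close>

definition is_moore_penrose :: "'a :: conjugatable_field mat \<Rightarrow> 'a mat \<Rightarrow> bool" where
  "is_moore_penrose M N \<longleftrightarrow>
     N \<in> carrier_mat (dim_col M) (dim_row M) \<and>
     M * N * M = M \<and>
     N * M * N = N \<and>
     mat_adjoint (M * N) = M * N \<and>
     mat_adjoint (N * M) = N * M"

text \<open>For real and complex matrices exactly one matrix satisfies the Penrose conditions.
  Over an arbitrary field with conjugation there may be none, and the value below is then
  unspecified.\<close>

definition pinv :: "'a :: conjugatable_field mat \<Rightarrow> 'a mat" where
  "pinv M = (THE N. is_moore_penrose M N)"

end

theory Submission
  imports Defs
begin

text \<open>
  Write \<open>M = Y\<^sup>*AX\<close>, \<open>G = M\<^sup>+\<close> and \<open>C = XGY\<^sup>*\<close>, so that the matrix in question is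
  \<open>A - ACA\<close>. From \<open>GMG = G\<close> one gets \<open>CAC = X(GMG)Y\<^sup>* = C\<close>, that is, \<open>C\<close> is an outer inverse
  of \<open>A\<close>. Restrict the map \<open>v \<mapsto> Cv\<close> to the column space of \<open>A\<close>. Its image is the column space
  of \<open>CA\<close>. Its kernel is the column space of \<open>A - ACA\<close>: if \<open>CAx = 0\<close> then
  \<open>Ax = (A - ACA)x\<close>, and conversely \<open>C(A - ACA) = CA - (CAC)A = 0\<close>. Rank-nullity therefore gives
  \<open>rank(CA) + rank(A - ACA) = rank A\<close> (lemma \<open>rank_diff_outer_inverse\<close>).

  It remains to see that \<open>rank(CA) = rank M\<close>. Each of the two matrices is a product with the other
  as a factor, since \<open>CA = XG \<cdot> M \<cdot> GY\<^sup>*A\<close> by \<open>GMG = G\<close> and \<open>M = Y\<^sup>*A \<cdot> CA \<cdot> X\<close> by \<open>MGM = M\<close>, and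
  a product has at most the rank of each of its factors.

  As \<open>pinv\<close> is a definite description, the Penrose equations for \<open>G\<close> require that the pseudoinverse
  exists and is unique. Existence is obtained without a spectral or singular value decomposition:
  over any field a matrix \<open>M\<close> has an inner inverse, \<open>MHM = M\<close>
  (lemma \<open>exists_inner_inverse\<close>); an inner inverse of \<open>M\<^sup>*M\<close> yields one of \<open>M\<close> for which \<open>MH\<close> is
  Hermitian; the same for \<open>M\<^sup>*\<close> yields an inner inverse \<open>L\<close> for which \<open>LM\<close> is Hermitian; and
  \<open>LMH\<close> satisfies all four equations.
\<close>

section \<open>Rank under multiplication\<close>

text \<open>With dimensions as side conditions instead of carriers, the simplifier can normalize products
  of rectangular matrices without having to guess the intermediate dimensions.\<close>

lemma mult_mat_assoc_dim:
  fixes A B C :: "'a :: semiring_0 mat"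
  assumes "dim_col A = dim_row B" "dim_col B = dim_row C"
  shows "A * B * C = A * (B * C)"
  using assms by (intro assoc_mult_mat) auto

context vec_space
begin

lemma rank_eq_dim_col_space: "rank A = vectorspace.dim class_ring (vs (col_space A))"
  by (simp add: rank_def col_space_def)

lemma col_space_subspace:
  assumes "A \<in> carrier_mat n c"
  shows "VectorSpace.subspace class_ring (col_space A) V"
  unfolding col_space_def using assms cols_dim[of A] by (intro span_is_subspace) auto

lemma col_space_eq_image:
  assumes "A \<in> carrier_mat n c"
  shows "col_space A = (\<lambda>x. A *\<^sub>v x) ` carrier_vec c"
  unfolding col_space_eq[OF assms] using assms by auto

lemma rank_mono_col_space:
  assumes A: "A \<in> carrier_mat n c" and B: "B \<in> carrier_mat n d"
    and sub: "col_space A \<subseteq> col_space B"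
  shows "rank A \<le> rank B"
proof -
  have "VectorSpace.subspace class_ring (col_space A) (vs (col_space B))"
    by (rule nested_subspaces[OF col_space_subspace[OF B] col_space_subspace[OF A] sub])
  moreover have "vectorspace.fin_dim class_ring (vs (col_space A))"
    "vectorspace.fin_dim class_ring (vs (col_space B))"
    using fin_dim_span_cols[OF A] fin_dim_span_cols[OF B] by (simp_all add: col_space_def)
  ultimately show ?thesis
    unfolding rank_eq_dim_col_space
    using vectorspace.subspace_dim[OF subspace_is_vs[OF col_space_subspace[OF B]]] by auto
qed

lemma rank_mult_le_left_factor:
  assumes A: "A \<in> carrier_mat n c" and B: "B \<in> carrier_mat c d"
  shows "rank (A * B) \<le> rank A"
proof (rule rank_mono_col_space[OF _ A])
  show AB: "A * B \<in> carrier_mat n d" using A B by auto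
  show "col_space (A * B) \<subseteq> col_space A"
    unfolding col_space_eq_image[OF AB] col_space_eq_image[OF A] using A B by auto
qed

end

text \<open>Rank-nullity for \<open>v \<mapsto> Cv\<close> restricted to the column space of \<open>A\<close>, whose image is the column
  space of \<open>CA\<close>.\<close>

lemma rank_nullity_col_space:
  fixes A C :: "'a :: field mat"
  assumes C: "C \<in> carrier_mat r m" and A: "A \<in> carrier_mat m c"
  shows "vec_space.rank r (C * A)
      + vectorspace.dim class_ring
          ((module_vec TYPE('a) m)\<lparr>carrier := {v \<in> vec_space.col_space m A. C *\<^sub>v v = 0\<^sub>v r}\<rparr>)
      = vec_space.rank m A"
proof -
  interpret m: vec_space "TYPE('a)" m .
  interpret r: vec_space "TYPE('a)" r .
  let ?W = "m.col_space A"
  have W: "VectorSpace.subspace class_ring ?W m.V" by (rule m.col_space_subspace[OF A])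
  have Wc: "?W \<subseteq> carrier_vec m" unfolding m.col_space_eq_image[OF A] using A by auto
  have CA: "C * A \<in> carrier_mat r c" using C A by auto
  interpret L: linear_map class_ring "m.vs ?W" r.V "\<lambda>v. C *\<^sub>v v"
    unfolding linear_map_def mod_hom_def mod_hom_axioms_def
  proof (intro conjI)
    show vsW: "vectorspace class_ring (m.vs ?W)" by (rule m.subspace_is_vs[OF W])
    show vsV: "vectorspace class_ring r.V" by (rule vec_vs)
    show "Module.module class_ring (m.vs ?W)" using vsW by (simp add: vectorspace_def)
    show "Module.module class_ring r.V" using vsV by (simp add: vectorspace_def)
    show "(\<lambda>v. C *\<^sub>v v) \<in> LinearCombinations.module_hom class_ring (m.vs ?W) r.V"
      unfolding LinearCombinations.module_hom_def using C Wc
      by (auto simp: mult_add_distrib_mat_vec[of _ r m] mult_mat_vec[of _ r m] subset_iff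
          class_ring_simps module_vec_simps)
  qed
  have fd: "vectorspace.fin_dim class_ring (m.vs ?W)"
    using m.fin_dim_span_cols[OF A] by (simp add: m.col_space_def)
  have im: "L.im = r.col_space (C * A)"
  proof -
    have "L.im = (\<lambda>v. C *\<^sub>v v) ` ?W" by (simp add: L.im_def)
    also have "\<dots> = r.col_space (C * A)"
      unfolding r.col_space_eq_image[OF CA] m.col_space_eq_image[OF A] image_image
      using C A by (intro image_cong) auto
    finally show ?thesis .
  qed
  have ker: "L.ker = {v \<in> ?W. C *\<^sub>v v = 0\<^sub>v r}"
    unfolding L.ker_def by (simp add: module_vec_simps)
  from L.rank_nullity[OF fd] show ?thesis
    by (simp add: im ker r.rank_eq_dim_col_space m.rank_eq_dim_col_space)
qed

corollary rank_mult_le_right_factor: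
  fixes A C :: "'a :: field mat"
  assumes "C \<in> carrier_mat r m" and "A \<in> carrier_mat m c"
  shows "vec_space.rank r (C * A) \<le> vec_space.rank m A"
  using rank_nullity_col_space[OF assms] by linarith

text \<open>The kernel of \<open>C\<close> within the column space of \<open>A\<close> is exactly the column space of \<open>A - ACA\<close>:
  \<open>A - ACA = A(1 - CA)\<close> maps into it because \<open>CAC = C\<close>, and \<open>A - ACA\<close> agrees with \<open>A\<close> on every
  \<open>x\<close> with \<open>CAx = 0\<close>.\<close>

theorem rank_diff_outer_inverse:
  fixes A C :: "'a :: field mat"
  assumes A: "A \<in> carrier_mat m n" and C: "C \<in> carrier_mat n m" and CAC: "C * A * C = C"
  shows "vec_space.rank n (C * A) + vec_space.rank m (A - A * C * A) = vec_space.rank m A"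
proof -
  interpret m: vec_space "TYPE('a)" m .
  let ?B = "A - A * C * A"
  have B: "?B \<in> carrier_mat m n" using A C by auto
  have Bv: "?B *\<^sub>v x = A *\<^sub>v x - A *\<^sub>v (C *\<^sub>v (A *\<^sub>v x))" if "x \<in> carrier_vec n" for x
  proof -
    have Ax: "A *\<^sub>v x \<in> carrier_vec m" using A that by auto
    have "A * C * A *\<^sub>v x = (A * C) *\<^sub>v (A *\<^sub>v x)"
      using A C that by (intro assoc_mult_mat_vec[of _ m m _ n]) auto
    also have "\<dots> = A *\<^sub>v (C *\<^sub>v (A *\<^sub>v x))"
      by (rule assoc_mult_mat_vec[OF A C Ax])
    finally show ?thesis
      using A C that by (subst minus_mult_distrib_mat_vec[of _ m n]) auto
  qed
  have CAB: "C *\<^sub>v (?B *\<^sub>v x) = 0\<^sub>v n" if x: "x \<in> carrier_vec n" for x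
  proof -
    have Ax: "A *\<^sub>v x \<in> carrier_vec m" using A x by auto
    have "C *\<^sub>v (A *\<^sub>v (C *\<^sub>v (A *\<^sub>v x))) = (C * A * C) *\<^sub>v (A *\<^sub>v x)"
      using A C Ax by (simp add: assoc_mult_mat_vec[of _ n n _ m] assoc_mult_mat_vec[of _ n m _ n] del: assoc_mult_mat)
    then have "C *\<^sub>v (A *\<^sub>v (C *\<^sub>v (A *\<^sub>v x))) = C *\<^sub>v (A *\<^sub>v x)"
      by (simp only: CAC)
    then show ?thesis
      unfolding Bv[OF x] using A C Ax by (subst mult_minus_distrib_mat_vec[of _ n m]) auto
  qed
  have "{v \<in> m.col_space A. C *\<^sub>v v = 0\<^sub>v n} = m.col_space ?B"
  proof (intro subset_antisym subsetI)
    fix v assume "v \<in> {v \<in> m.col_space A. C *\<^sub>v v = 0\<^sub>v n}"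
    then obtain x where x: "x \<in> carrier_vec n" "v = A *\<^sub>v x" "C *\<^sub>v (A *\<^sub>v x) = 0\<^sub>v n"
      unfolding m.col_space_eq_image[OF A] by auto
    have "A *\<^sub>v 0\<^sub>v n = 0\<^sub>v m" using A by auto
    then have "v = ?B *\<^sub>v x" using A x by (auto simp: Bv)
    then show "v \<in> m.col_space ?B" unfolding m.col_space_eq_image[OF B] using x by auto
  next
    fix v assume "v \<in> m.col_space ?B"
    then obtain x where x: "x \<in> carrier_vec n" "v = ?B *\<^sub>v x"
      unfolding m.col_space_eq_image[OF B] by auto
    have "v = A *\<^sub>v (x - C *\<^sub>v (A *\<^sub>v x))"
      unfolding x(2) Bv[OF x(1)] using A C x(1)
      by (subst mult_minus_distrib_mat_vec[of _ m n]) auto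
    then have "v \<in> m.col_space A"
      unfolding m.col_space_eq_image[OF A] using A C x by auto
    then show "v \<in> {v \<in> m.col_space A. C *\<^sub>v v = 0\<^sub>v n}" using CAB x by simp
  qed
  then show ?thesis
    using rank_nullity_col_space[OF C A] by (simp add: m.rank_eq_dim_col_space)
qed

section \<open>Generalized inverses over a field\<close>

text \<open>Wedderburn's rank-one reduction step: \<open>MEM\<close> is the product of column \<open>j\<close> and row \<open>i\<close> of \<open>M\<close>,
  divided by the pivot. It agrees with \<open>M\<close> in row \<open>i\<close> and column \<open>j\<close>, so subtracting it from \<open>M\<close>
  clears both.\<close>

lemma exists_rank_one_reduction:
  fixes M :: "'a :: field mat"
  assumes M: "M \<in> carrier_mat r c" and i: "i < r" and j: "j < c" and pivot: "M $$ (i,j) \<noteq> 0"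
  obtains E where "E \<in> carrier_mat c r"
    and "\<And>a b. a < r \<Longrightarrow> b < c \<Longrightarrow> (M * E * M) $$ (a,b) = M $$ (a,j) * M $$ (i,b) / M $$ (i,j)"
proof
  let ?E = "mat c r (\<lambda>(a,b). if a = j \<and> b = i then 1 / M $$ (i,j) else 0)"
  show E: "?E \<in> carrier_mat c r" by simp
  fix a b assume a: "a < r" and b: "b < c"
  have EM: "(?E * M) $$ (x,b) = (if x = j then M $$ (i,b) / M $$ (i,j) else 0)" if "x < c" for x
  proof -
    have "(?E * M) $$ (x,b)
        = (\<Sum>y<r. (if x = j \<and> y = i then 1 / M $$ (i,j) else 0) * M $$ (y,b))"
      using M b that by (auto simp: scalar_prod_def atLeast0LessThan intro!: sum.cong)
    also have "\<dots> = (\<Sum>y<r. if y = i then (if x = j then M $$ (i,b) / M $$ (i,j) else 0) else 0)"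
      by (intro sum.cong) auto
    finally show ?thesis using i by simp
  qed
  have "(M * (?E * M)) $$ (a,b) = (\<Sum>x<c. M $$ (a,x) * (?E * M) $$ (x,b))"
    using M a b by (auto simp: scalar_prod_def atLeast0LessThan intro!: sum.cong)
  also have "\<dots> = (\<Sum>x<c. if x = j then M $$ (a,j) * M $$ (i,b) / M $$ (i,j) else 0)"
    by (intro sum.cong) (auto simp: EM)
  finally show "(M * ?E * M) $$ (a,b) = M $$ (a,j) * M $$ (i,b) / M $$ (i,j)"
    using M j by (simp add: mult_mat_assoc_dim)
qed

text \<open>Induction on the number of nonzero rows. The rank-one reduction \<open>M\<^sub>1 = M - MEM\<close> clears row \<open>i\<close>
  and keeps every zero row zero, so \<open>M\<^sub>1\<close> has an inner inverse \<open>H\<^sub>1\<close>. As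
  \<open>M\<^sub>1 = M(1 - EM) = (1 - ME)M\<close>, the matrix \<open>H = E + (1 - EM)H\<^sub>1(1 - ME)\<close> satisfies
  \<open>MHM = MEM + M\<^sub>1H\<^sub>1M\<^sub>1 = MEM + M\<^sub>1 = M\<close>.\<close>

lemma exists_inner_inverse:
  fixes M :: "'a :: field mat"
  assumes "M \<in> carrier_mat r c"
  shows "\<exists>H \<in> carrier_mat c r. M * H * M = M"
  using assms
proof (induction "card {a. a < r \<and> (\<exists>b<c. M $$ (a,b) \<noteq> 0)}" arbitrary: M rule: less_induct)
  case less
  note M = less.prems
  show ?case
  proof (cases "\<exists>i<r. \<exists>j<c. M $$ (i,j) \<noteq> 0")
    case False
    then have "M = 0\<^sub>m r c" using M by (intro eq_matI) auto
    then show ?thesis by (intro bexI[of _ "0\<^sub>m c r"]) auto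
  next
    case True
    then obtain i j where ij: "i < r" "j < c" "M $$ (i,j) \<noteq> 0" by blast
    obtain E where E: "E \<in> carrier_mat c r"
      and MEM: "\<And>a b. a < r \<Longrightarrow> b < c \<Longrightarrow> (M * E * M) $$ (a,b) = M $$ (a,j) * M $$ (i,b) / M $$ (i,j)"
      by (rule exists_rank_one_reduction[OF M ij]) blast
    let ?M1 = "M - M * E * M"
    have M1: "?M1 \<in> carrier_mat r c" using M E by auto
    have M1_index: "?M1 $$ (a,b) = M $$ (a,b) - M $$ (a,j) * M $$ (i,b) / M $$ (i,j)"
      if "a < r" "b < c" for a b using M E that by (simp add: MEM del: index_mult_mat(1) assoc_mult_mat)
    have "{a. a < r \<and> (\<exists>b<c. ?M1 $$ (a,b) \<noteq> 0)} \<subset> {a. a < r \<and> (\<exists>b<c. M $$ (a,b) \<noteq> 0)}"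
    proof
      show "{a. a < r \<and> (\<exists>b<c. ?M1 $$ (a,b) \<noteq> 0)} \<subseteq> {a. a < r \<and> (\<exists>b<c. M $$ (a,b) \<noteq> 0)}"
      proof clarify
        fix a b assume ab: "a < r" "b < c" "?M1 $$ (a,b) \<noteq> 0"
        show "\<exists>b<c. M $$ (a,b) \<noteq> 0"
        proof (rule ccontr)
          assume "\<not> (\<exists>b<c. M $$ (a,b) \<noteq> 0)"
          then have "?M1 $$ (a,b) = 0" using ab ij(2) by (simp add: M1_index del: index_minus_mat)
          then show False using ab by simp
        qed
      qed
      have "i \<notin> {a. a < r \<and> (\<exists>b<c. ?M1 $$ (a,b) \<noteq> 0)}"
        using ij by (auto simp: M1_index simp del: index_minus_mat)
      moreover have "i \<in> {a. a < r \<and> (\<exists>b<c. M $$ (a,b) \<noteq> 0)}" using ij by auto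
      ultimately show "{a. a < r \<and> (\<exists>b<c. ?M1 $$ (a,b) \<noteq> 0)} \<noteq> {a. a < r \<and> (\<exists>b<c. M $$ (a,b) \<noteq> 0)}"
        by blast
    qed
    then have "card {a. a < r \<and> (\<exists>b<c. ?M1 $$ (a,b) \<noteq> 0)} < card {a. a < r \<and> (\<exists>b<c. M $$ (a,b) \<noteq> 0)}"
      by (intro psubset_card_mono) auto
    from less.hyps[OF this M1] obtain H1 where H1: "H1 \<in> carrier_mat c r"
      and H1_inv: "?M1 * H1 * ?M1 = ?M1" by blast
    let ?L = "1\<^sub>m c - E * M" and ?R = "1\<^sub>m r - M * E"
    let ?H = "E + ?L * H1 * ?R"
    have LR: "?L \<in> carrier_mat c c" "?R \<in> carrier_mat r r" using M E by auto
    have M_times_L: "M * ?L = ?M1" using M E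
      by (subst mult_minus_distrib_mat[of _ r c _ c]) (auto simp: mult_mat_assoc_dim)
    have R_times_M: "?R * M = ?M1" using M E
      by (subst minus_mult_distrib_mat[of _ r r _ _ c]) auto
    have H: "?H \<in> carrier_mat c r" using E LR H1 by auto
    have "M * ?H * M = M * E * M + M * (?L * H1 * ?R) * M"
      using M E LR H1 by (simp add: mult_add_distrib_mat[of _ r c _ r] add_mult_distrib_mat[of _ r r _ _ c])
    also have "M * (?L * H1 * ?R) * M = (M * ?L) * H1 * (?R * M)"
      using M E H1 by (simp add: mult_mat_assoc_dim)
    also have "\<dots> = ?M1" by (simp only: M_times_L R_times_M H1_inv)
    also have "M * E * M + ?M1 = M" using M E by (intro eq_matI) auto
    finally show ?thesis using H by blast
  qed
qed

section \<open>Existence and uniqueness of the Moore--Penrose inverse\<close>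

lemma mat_adjoint_dim [simp]:
  "dim_row (mat_adjoint A) = dim_col A" "dim_col (mat_adjoint A) = dim_row A"
  by (auto simp: mat_adjoint_def)

lemma mat_adjoint_carrier [simp]:
  "A \<in> carrier_mat r c \<Longrightarrow> mat_adjoint A \<in> carrier_mat c r"
  by (intro carrier_matI) auto

lemma mat_adjoint_index [simp]:
  "i < dim_col A \<Longrightarrow> j < dim_row A \<Longrightarrow> mat_adjoint A $$ (i,j) = conjugate (A $$ (j,i))"
  by (auto simp: mat_adjoint_def mat_of_rows_def)

lemma mat_adjoint_mat_adjoint [simp]: "mat_adjoint (mat_adjoint A) = A"
  by (intro eq_matI) auto

lemma mat_adjoint_mult:
  fixes A B :: "'a :: conjugatable_field mat"
  assumes "dim_col A = dim_row B"
  shows "mat_adjoint (A * B) = mat_adjoint B * mat_adjoint A"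
  using assms
  by (intro eq_matI) (auto simp: scalar_prod_def sum_conjugate conjugate_dist_mul mult.commute intro!: sum.cong)

text \<open>The diagonal entries of \<open>B\<^sup>*B\<close> are the squared norms of the columns of \<open>B\<close>. This is where
  positivity of \<open>a \<cdot> conjugate a\<close> enters.\<close>

lemma mat_adjoint_mult_self_eq_0:
  fixes B :: "'a :: conjugatable_ordered_field mat"
  assumes B: "B \<in> carrier_mat r c" and zero: "mat_adjoint B * B = 0\<^sub>m c c"
  shows "B = 0\<^sub>m r c"
proof (rule eq_matI)
  fix i j assume "i < dim_row (0\<^sub>m r c :: 'a mat)" "j < dim_col (0\<^sub>m r c :: 'a mat)"
  then have i: "i < r" and j: "j < c" by auto
  have colB: "col B j \<in> carrier_vec r" using B by auto
  have "col B j \<bullet>c col B j = (mat_adjoint B * B) $$ (j,j)"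
    using B j by (auto simp: scalar_prod_def mult.commute intro!: sum.cong)
  also have "\<dots> = 0" using j by (simp add: zero)
  finally have "col B j = 0\<^sub>v r" using conjugate_square_eq_0_vec[OF colB] by simp
  then have "col B j $ i = 0" using i by simp
  then show "B $$ (i,j) = 0\<^sub>m r c $$ (i,j)" using B i j by simp
qed (use B in auto)

text \<open>Let \<open>G\<close> be an inner inverse of \<open>M\<^sup>*M\<close> and put \<open>H = GM\<^sup>*\<close>, so that \<open>P = MH\<close> will be the
  orthogonal projection onto the column space of \<open>M\<close>. The left factor \<open>M\<^sup>*\<close> cancels from
  \<open>M\<^sup>*PM = M\<^sup>*M\<close>, giving \<open>PM = M\<close>. Hence \<open>PP\<^sup>* = (PM)G\<^sup>*M\<^sup>* = P\<^sup>*\<close>, and as \<open>PP\<^sup>*\<close> is Hermitian,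
  so is \<open>P\<close>.\<close>

lemma exists_inner_inverse_hermitian_left:
  fixes M :: "'a :: conjugatable_ordered_field mat"
  assumes M: "M \<in> carrier_mat r c"
  obtains H where "H \<in> carrier_mat c r" "M * H * M = M" "mat_adjoint (M * H) = M * H"
proof -
  let ?S = "mat_adjoint M * M"
  obtain G where G: "G \<in> carrier_mat c c" and SGS: "?S * G * ?S = ?S"
    using exists_inner_inverse[of ?S c c] mult_carrier_mat[OF mat_adjoint_carrier[OF M] M] by blast
  let ?P = "M * (G * mat_adjoint M)"
  let ?D = "?P * M - M"
  have D: "?D \<in> carrier_mat r c" using M G by auto
  have MD: "mat_adjoint M * ?D = 0\<^sub>m c c"
  proof -
    have "mat_adjoint M * ?D = ?S * G * ?S - ?S"
      using M G by (subst mult_minus_distrib_mat[of _ c r _ c]) (auto simp: mult_mat_assoc_dim)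
    then show ?thesis
      by (simp only: SGS minus_r_inv_mat[OF mult_carrier_mat[OF mat_adjoint_carrier[OF M] M]])
  qed
  \<comment> \<open>\<open>D\<close> is itself a right multiple of \<open>M\<close>, so \<open>M\<^sup>*D = 0\<close> forces \<open>D\<^sup>*D = 0\<close>.\<close>
  have "mat_adjoint ?D * ?D = 0\<^sub>m c c"
  proof -
    let ?T = "G * ?S - 1\<^sub>m c"
    have T: "?T \<in> carrier_mat c c" using M G by auto
    have "?D = M * ?T"
      using M G by (subst mult_minus_distrib_mat[of _ r c _ c]) (auto simp: mult_mat_assoc_dim)
    then have "mat_adjoint ?D * ?D = mat_adjoint ?T * mat_adjoint M * ?D"
      using M T by (metis carrier_matD mat_adjoint_mult)
    also have "\<dots> = mat_adjoint ?T * (mat_adjoint M * ?D)"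
      using M T D by (intro assoc_mult_mat[of _ c c _ r _ c]) auto
    finally show ?thesis using T by (simp only: MD) auto
  qed
  then have D0: "?D = 0\<^sub>m r c" by (rule mat_adjoint_mult_self_eq_0[OF D])
  have PM: "?P * M = M"
  proof (rule eq_matI)
    fix i j assume "i < dim_row M" "j < dim_col M"
    moreover from this have "?D $$ (i,j) = 0" using M by (simp only: D0) auto
    ultimately show "(?P * M) $$ (i,j) = M $$ (i,j)" using M G by (simp del: index_mult_mat(1))
  qed (use M G in auto)
  have adjP: "mat_adjoint ?P = M * (mat_adjoint G * mat_adjoint M)"
    using M G by (simp add: mat_adjoint_mult mult_mat_assoc_dim)
  have "?P * mat_adjoint ?P = (?P * M) * (mat_adjoint G * mat_adjoint M)"
    unfolding adjP using M G by (simp add: mult_mat_assoc_dim)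
  then have PP: "?P * mat_adjoint ?P = mat_adjoint ?P"
    unfolding PM adjP .
  have "mat_adjoint (?P * mat_adjoint ?P) = ?P * mat_adjoint ?P"
    using M G by (subst mat_adjoint_mult) auto
  then have herm: "mat_adjoint ?P = ?P" unfolding PP by simp
  show thesis
    using M G PM herm by (intro that[of "G * mat_adjoint M"]) auto
qed

text \<open>If \<open>H\<close> and \<open>L\<close> are inner inverses of \<open>M\<close> with \<open>MH\<close> and \<open>LM\<close> Hermitian, then \<open>N = LMH\<close> has
  \<open>MN = MH\<close> and \<open>NM = LM\<close>, and the Penrose conditions follow. The matrix \<open>L\<close> is the adjoint of a
  one-sided Hermitian inner inverse of \<open>M\<^sup>*\<close>.\<close>

lemma exists_moore_penrose:
  fixes M :: "'a :: conjugatable_ordered_field mat"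
  shows "\<exists>N. is_moore_penrose M N"
proof -
  define r c where "r = dim_row M" and "c = dim_col M"
  have M: "M \<in> carrier_mat r c" by (auto simp: r_def c_def)
  obtain H where H: "H \<in> carrier_mat c r" "M * H * M = M" "mat_adjoint (M * H) = M * H"
    using exists_inner_inverse_hermitian_left[OF M] .
  obtain K where K: "K \<in> carrier_mat r c" "mat_adjoint M * K * mat_adjoint M = mat_adjoint M"
    "mat_adjoint (mat_adjoint M * K) = mat_adjoint M * K"
    using exists_inner_inverse_hermitian_left[OF mat_adjoint_carrier[OF M]] .
  let ?L = "mat_adjoint K"
  have L: "?L \<in> carrier_mat c r" using K by simp
  have M_L_M: "M * ?L * M = M"
  proof -
    have "mat_adjoint (mat_adjoint M * K * mat_adjoint M) = M * ?L * M"
      using M K(1) by (simp add: mat_adjoint_mult mult_mat_assoc_dim)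
    then show ?thesis by (simp add: K(2))
  qed
  have LM: "mat_adjoint (?L * M) = ?L * M"
    using M K(1,3) by (simp add: mat_adjoint_mult)
  let ?N = "?L * M * H"
  have MN: "M * ?N = M * H"
  proof -
    have "M * ?N = M * ?L * M * H" using M K(1) H(1) by (simp add: mult_mat_assoc_dim)
    then show ?thesis by (simp only: M_L_M)
  qed
  have NM: "?N * M = ?L * M"
  proof -
    have "?N * M = ?L * (M * H * M)" using M K(1) H(1) by (simp add: mult_mat_assoc_dim)
    then show ?thesis by (simp only: H(2))
  qed
  have NMN: "?N * M * ?N = ?N"
  proof -
    have "?N * M * ?N = ?L * (M * ?L * M) * H"
      unfolding NM using M K(1) H(1) by (simp add: mult_mat_assoc_dim)
    then show ?thesis by (simp only: M_L_M)
  qed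
  have "is_moore_penrose M ?N"
    unfolding is_moore_penrose_def MN NM H(2,3) LM NMN[unfolded NM]
    using M L H(1) by auto
  then show ?thesis ..
qed

text \<open>A Hermitian idempotent is determined by its range, and also by its kernel. The range of \<open>MN\<close> and
  of \<open>MN'\<close> is that of \<open>M\<close>, and the kernel of \<open>NM\<close> and of \<open>N'M\<close> is that of \<open>M\<close>. Hence
  \<open>MN = MN'\<close> and \<open>NM = N'M\<close>, and
  \<open>N = NMN = N'MN = N'MN' = N'\<close>.\<close>

lemma moore_penrose_unique:
  fixes M :: "'a :: conjugatable_field mat"
  assumes N: "is_moore_penrose M N" and N': "is_moore_penrose M N'"
  shows "N = N'"
proof -
  note N = N[unfolded is_moore_penrose_def] and N' = N'[unfolded is_moore_penrose_def]
  have [simp]: "dim_row N = dim_col M" "dim_col N = dim_row M"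
    "dim_row N' = dim_col M" "dim_col N' = dim_row M"
    using N N' by auto
  have "M * N = mat_adjoint (M * N)" using N by simp
  also have "\<dots> = mat_adjoint ((M * N') * (M * N))"
  proof -
    have "(M * N') * (M * N) = M * N' * M * N" by (simp add: mult_mat_assoc_dim)
    then show ?thesis using N' by simp
  qed
  also have "\<dots> = (M * N) * (M * N')" using N N' by (subst mat_adjoint_mult) auto
  also have "\<dots> = M * N * M * N'" by (simp add: mult_mat_assoc_dim)
  finally have MN: "M * N = M * N'" using N by simp
  have "N * M = mat_adjoint (N * M)" using N by simp
  also have "\<dots> = mat_adjoint ((N * M) * (N' * M))"
  proof -
    have "(N * M) * (N' * M) = N * (M * N' * M)" by (simp add: mult_mat_assoc_dim)
    then show ?thesis using N' by simp
  qed
  also have "\<dots> = (N' * M) * (N * M)" using N N' by (subst mat_adjoint_mult) auto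
  also have "\<dots> = N' * (M * N * M)" by (simp add: mult_mat_assoc_dim)
  finally have NM: "N * M = N' * M" using N by simp
  have "N = N * M * N" using N by simp
  also have "\<dots> = N' * (M * N)" unfolding NM by (simp add: mult_mat_assoc_dim)
  also have "\<dots> = N' * M * N'" unfolding MN by (simp add: mult_mat_assoc_dim)
  also have "\<dots> = N'" using N' by simp
  finally show ?thesis .
qed

lemma is_moore_penrose_pinv:
  fixes M :: "'a :: conjugatable_ordered_field mat"
  shows "is_moore_penrose M (pinv M)"
proof -
  obtain N where N: "is_moore_penrose M N" using exists_moore_penrose by blast
  show ?thesis
    unfolding pinv_def by (rule theI[of "is_moore_penrose M", OF N moore_penrose_unique[OF _ N]])
qed

section \<open>Rank reduction by the pseudoinverse\<close>

text \<open>Stated as a sum of natural numbers and over any field with a positive conjugation, so that the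
  real and the complex case are both instances.\<close>

lemma rank_diff_pinv:
  fixes A X Y :: "'a :: conjugatable_ordered_field mat"
  assumes A: "A \<in> carrier_mat m n" and X: "X \<in> carrier_mat n p" and Y: "Y \<in> carrier_mat m q"
  shows "vec_space.rank q (mat_adjoint Y * A * X)
      + vec_space.rank m (A - (A * X) * pinv (mat_adjoint Y * A * X) * (mat_adjoint Y * A))
      = vec_space.rank m A"
proof -
  define M where "M = mat_adjoint Y * A * X"
  define G where "G = pinv M"
  define C where "C = X * G * mat_adjoint Y"
  have M: "M \<in> carrier_mat q p" using A X Y by (auto simp: M_def)
  have G: "G \<in> carrier_mat p q" and MGM: "M * G * M = M" and GMG: "G * M * G = G"
    using is_moore_penrose_pinv[of M] M by (auto simp: is_moore_penrose_def G_def)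
  have C: "C \<in> carrier_mat n m" using X Y G by (auto simp: C_def)
  have "C * A * C = X * (G * M * G) * mat_adjoint Y"
    using A X Y G by (simp add: C_def M_def mult_mat_assoc_dim)
  then have CAC: "C * A * C = C" by (simp only: GMG C_def)
  have ACA: "A * C * A = (A * X) * G * (mat_adjoint Y * A)"
    using A X Y G by (simp add: C_def mult_mat_assoc_dim)
  have CA: "C * A \<in> carrier_mat n n" using C A by auto
  have "vec_space.rank n (C * A) = vec_space.rank q M"
  proof (rule antisym)
    have "C * A = X * (G * M * G) * mat_adjoint Y * A" by (simp only: GMG C_def)
    also have "\<dots> = (X * G) * (M * (G * (mat_adjoint Y * A)))"
      using A X Y G M by (simp add: mult_mat_assoc_dim)
    also have "vec_space.rank n \<dots> \<le> vec_space.rank q (M * (G * (mat_adjoint Y * A)))"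
      using A X Y G M by (intro rank_mult_le_right_factor[of _ n q _ n]) auto
    also have "\<dots> \<le> vec_space.rank q M"
      using A Y G M by (intro vec_space.rank_mult_le_left_factor[of _ q p _ n]) auto
    finally show "vec_space.rank n (C * A) \<le> vec_space.rank q M" .
    have "M = (mat_adjoint Y * A) * ((C * A) * X)"
    proof -
      have "M * G * M = (mat_adjoint Y * A) * ((C * A) * X)"
        using A X Y G by (simp add: C_def M_def mult_mat_assoc_dim)
      then show ?thesis by (simp only: MGM)
    qed
    also have "vec_space.rank q \<dots> \<le> vec_space.rank n ((C * A) * X)"
      by (rule rank_mult_le_right_factor[OF mult_carrier_mat[OF mat_adjoint_carrier[OF Y] A]
            mult_carrier_mat[OF CA X]])
    also have "\<dots> \<le> vec_space.rank n (C * A)"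
      by (rule vec_space.rank_mult_le_left_factor[OF CA X])
    finally show "vec_space.rank q M \<le> vec_space.rank n (C * A)" .
  qed
  then show ?thesis
    using rank_diff_outer_inverse[OF A C CAC] by (simp add: ACA M_def G_def)
qed

theorem theorem5p1:
  shows
    "(\<forall>(m::nat) (n::nat) (p::nat) (q::nat) (k::nat) (A::real mat) (X::real mat) (Y::real mat).
        A \<in> carrier_mat m n \<longrightarrow> X \<in> carrier_mat n p \<longrightarrow> Y \<in> carrier_mat m q \<longrightarrow>
        vec_space.rank q (mat_adjoint Y * A * X) = k \<longrightarrow>
        int (vec_space.rank m
              (A - (A * X) * pinv (mat_adjoint Y * A * X) * (mat_adjoint Y * A)))
          = int (vec_space.rank m A) - int k)
     \<and>
     (\<forall>(m::nat) (n::nat) (p::nat) (q::nat) (k::nat) (A::complex mat) (X::complex mat) (Y::complex mat).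
        A \<in> carrier_mat m n \<longrightarrow> X \<in> carrier_mat n p \<longrightarrow> Y \<in> carrier_mat m q \<longrightarrow>
        vec_space.rank q (mat_adjoint Y * A * X) = k \<longrightarrow>
        int (vec_space.rank m
              (A - (A * X) * pinv (mat_adjoint Y * A * X) * (mat_adjoint Y * A)))
          = int (vec_space.rank m A) - int k)"
proof (intro conjI allI impI; elim subst)
  fix m n p q :: nat and A X Y :: "real mat"
  assume "A \<in> carrier_mat m n" "X \<in> carrier_mat n p" "Y \<in> carrier_mat m q"
  from rank_diff_pinv[OF this]
  show "int (vec_space.rank m
        (A - (A * X) * pinv (mat_adjoint Y * A * X) * (mat_adjoint Y * A)))
      = int (vec_space.rank m A) - int (vec_space.rank q (mat_adjoint Y * A * X))"
    by linarith
next
  fix m n p q :: nat and A X Y :: "complex mat"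
  assume "A \<in> carrier_mat m n" "X \<in> carrier_mat n p" "Y \<in> carrier_mat m q"
  from rank_diff_pinv[OF this]
  show "int (vec_space.rank m
        (A - (A * X) * pinv (mat_adjoint Y * A * X) * (mat_adjoint Y * A)))
      = int (vec_space.rank m A) - int (vec_space.rank q (mat_adjoint Y * A * X))"
    by linarith
qed

end
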